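(* Let $\delta>0$ and let $D=D(n)$ be positive integers with $D(n)/n\to 0$ as $n\to\infty$. Then there is $n_0$ such that for every $n\ge n_0$, every integer $d$ with $1\le d\le D$, every input vector $\mathbf{x}\in\{0,1\}^n$ with exactly $d$ ones, and every integer $T\ge 2eD(1+\delta)\ln n$, the CoCo algorithm with $T$ tests and group sampling parameter $g=1/\ln\!\big(n/(n-D)\big)$ (rounded to an integer) satisfies $$\Pr[\hat{\mathbf{x}}\neq\mathbf{x}]\le n^{-\delta},$$ where the probability is over the random choice of the group-testing matrix.
   Context: Group testing: there are $n$ items, of which an unknown subset of $d$ items is defective, encoded by $\mathbf{x}\in\{0,1\}^n$ ($x_j=1$ iff item $j$ is defective). Only an upper bound $D\ge d$ is known to the algorithm. A $T\times n$ binary group-testing matrix $M=(m_{i,j})$ specifies non-adaptive tests: item $j$ is in test $i$ iff $m_{i,j}=1$. Measurements are noiseless: the outcome $y_i\in\{0,1\}$ of test $i$ is $1$ iff test $i$ contains at least one defective item. CoCo (Coupon Collector) algorithm. Encoding: with a group sampling parameter $g$ (a positive integer), each row $i$ of $M$ is generated independently by sampling uniformly with replacement from $\{1,\dots,n\}$ exactly $g$ times, and setting $m_{i,j}=1$ iff $j$ is sampled at least once. Decoding: $\hat{\mathbf{x}}$ is the binary vector with $\hat x_j=0$ iff there is a test $i$ with $y_i=0$ and $m_{i,j}=1$ (all other entries are $1$). *)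

theory Defs
  imports "HOL-Probability.Probability" "HOL-Probability.Product_PMF"
begin

text \<open>
  Items are \<open>{1..n}\<close> and tests are \<open>{1..T}\<close>.  Vectors and matrices are extensional functions,
  i.e. \<open>undefined\<close> outside their index sets, so that equality of functions is equality of vectors.
\<close>

definition binary_vectors :: "nat \<Rightarrow> (nat \<Rightarrow> nat) set" where
  "binary_vectors n = {1..n} \<rightarrow>\<^sub>E {0, 1}"

definition test_outcomes ::
  "nat \<Rightarrow> nat \<Rightarrow> (nat \<Rightarrow> nat \<Rightarrow> nat) \<Rightarrow> (nat \<Rightarrow> nat) \<Rightarrow> (nat \<Rightarrow> nat)" where
  "test_outcomes n T M x =
     (\<lambda>i\<in>{1..T}. if \<exists>j\<in>{1..n}. M i j = 1 \<and> x j = 1 then 1 else 0)"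

text \<open>The result of \<open>g\<close> independent uniform draws from \<open>{1..n}\<close>; meaningful for \<open>n \<ge> 1\<close>.\<close>

definition coco_samples :: "nat \<Rightarrow> nat \<Rightarrow> (nat \<Rightarrow> nat) pmf" where
  "coco_samples n g = Pi_pmf {1..g} undefined (\<lambda>_. pmf_of_set {1..n})"

definition coco_row :: "nat \<Rightarrow> nat \<Rightarrow> (nat \<Rightarrow> nat) pmf" where
  "coco_row n g =
     map_pmf (\<lambda>s. \<lambda>j\<in>{1..n}. if \<exists>k\<in>{1..g}. s k = j then 1 else 0) (coco_samples n g)"

definition coco_matrix :: "nat \<Rightarrow> nat \<Rightarrow> nat \<Rightarrow> (nat \<Rightarrow> nat \<Rightarrow> nat) pmf" where
  "coco_matrix n T g = Pi_pmf {1..T} undefined (\<lambda>_. coco_row n g)"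

definition coco_decode ::
  "nat \<Rightarrow> nat \<Rightarrow> (nat \<Rightarrow> nat \<Rightarrow> nat) \<Rightarrow> (nat \<Rightarrow> nat) \<Rightarrow> (nat \<Rightarrow> nat)" where
  "coco_decode n T M y =
     (\<lambda>j\<in>{1..n}. if \<exists>i\<in>{1..T}. y i = 0 \<and> M i j = 1 then 0 else 1)"

definition coco_error_prob :: "nat \<Rightarrow> nat \<Rightarrow> nat \<Rightarrow> (nat \<Rightarrow> nat) \<Rightarrow> real" where
  "coco_error_prob n T g x =
     measure_pmf.prob (coco_matrix n T g) {M. coco_decode n T M (test_outcomes n T M x) \<noteq> x}"

definition coco_group_size :: "nat \<Rightarrow> nat \<Rightarrow> real" where
  "coco_group_size n D = 1 / ln (real n / (real n - real D))"

text \<open>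
  No rounding direction is singled out: \<open>g\<close> may be the floor or the ceiling of \<open>r\<close>, which
  includes rounding to a nearest integer.
\<close>

definition is_rounding :: "nat \<Rightarrow> real \<Rightarrow> bool" where
  "is_rounding g r \<longleftrightarrow> int g = \<lfloor>r\<rfloor> \<or> int g = \<lceil>r\<rceil>"

end

theory Submission
  imports Defs
begin

text \<open>
  A test clears a non-defective item \<open>j\<close> if it contains \<open>j\<close> and no defective item, and decoding
  fails only if some non-defective item is cleared by no test. All draws of a test
  avoid \<open>k\<close> given items with probability \<open>(1 - k/n)\<^sup>g\<close>, so one test clears \<open>j\<close> with probability
  \<open>p = (1 - d/n)\<^sup>g - (1 - (d+1)/n)\<^sup>g\<close>, which decreases in \<open>d\<close>. For \<open>d = D\<close> and \<open>g\<close> close to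
  \<open>1 / ln (n/(n-D))\<close>, the first power is close to \<open>1/e\<close> and the ratio of the second to the first
  is at most about \<open>exp (-1/D)\<close>. As \<open>1 - exp (-v) \<ge> (3/5) v\<close> on \<open>[0,1]\<close>, this leaves enough slack
  for \<open>p \<ge> 1/(2eD)\<close> once \<open>D/n\<close> is small. The union bound gives error probability at
  most \<open>n (1-p)\<^sup>T \<le> n exp (-pT)\<close>.
\<close>

section \<open>Deterministic analysis of the decoder\<close>

text \<open>The predicate looks at a single row \<open>r\<close>, so for fixed \<open>j\<close> the
  events for different tests are independent and equally likely.\<close>

definition clears :: "nat \<Rightarrow> (nat \<Rightarrow> nat) \<Rightarrow> nat \<Rightarrow> (nat \<Rightarrow> nat) \<Rightarrow> bool" where
  "clears n x j r \<longleftrightarrow> (\<forall>k\<in>{1..n}. \<not> (r k = 1 \<and> x k = 1)) \<and> r j = 1"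

text \<open>Every test containing a defective item is positive, so a defective item is never
  declared non-defective. Only the other items need a clearing test.\<close>

lemma coco_decode_correct:
  assumes x: "x \<in> binary_vectors n"
    and cleared: "\<And>j. j \<in> {1..n} \<Longrightarrow> x j \<noteq> 1 \<Longrightarrow> \<exists>i\<in>{1..T}. clears n x j (M i)"
  shows "coco_decode n T M (test_outcomes n T M x) = x"
proof
  fix j
  let ?y = "test_outcomes n T M x"
  show "coco_decode n T M ?y j = x j"
  proof (cases "j \<in> {1..n}")
    case False
    then show ?thesis
      using x by (auto simp: binary_vectors_def coco_decode_def PiE_def extensional_def)
  next
    case True
    then have "x j \<in> {0, 1}"
      using x by (auto simp: binary_vectors_def PiE_def Pi_def)
    then consider "x j = 1" | "x j = 0" "x j \<noteq> 1" by auto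
    then show ?thesis
    proof cases
      case 1
      then have "\<not> (\<exists>i\<in>{1..T}. ?y i = 0 \<and> M i j = 1)"
        using True by (auto simp: test_outcomes_def split: if_splits)
      then show ?thesis using 1 True by (simp add: coco_decode_def)
    next
      case 2
      then obtain i where i: "i \<in> {1..T}" "clears n x j (M i)"
        using cleared True by blast
      then have "?y i = 0" "M i j = 1"
        by (auto simp: test_outcomes_def clears_def)
      then have "\<exists>i\<in>{1..T}. ?y i = 0 \<and> M i j = 1" using i by blast
      then show ?thesis using 2 True by (simp add: coco_decode_def)
    qed
  qed
qed

section \<open>Clearing probability of a row and the union bound\<close>

lemma prob_Pi_pmf_const_ball:
  assumes "finite A"
  shows "measure_pmf.prob (Pi_pmf A dflt (\<lambda>_. p)) {f. \<forall>x\<in>A. P (f x)} =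
    measure_pmf.prob p {y. P y} ^ card A"
proof -
  have "{f. \<forall>x\<in>A. P (f x)} = Pi A (\<lambda>_. {y. P y})" by (auto simp: Pi_def)
  then show ?thesis using measure_Pi_pmf_Pi[OF assms, of dflt "\<lambda>_. p"] by simp
qed

lemma prob_coco_samples_subset:
  assumes "n \<ge> 1" "A \<subseteq> {1..n}"
  shows "measure_pmf.prob (coco_samples n g) {s. \<forall>k\<in>{1..g}. s k \<in> A} = (real (card A) / real n) ^ g"
proof -
  have "measure_pmf.prob (pmf_of_set {1..n}) {y. y \<in> A} = real (card A) / real n"
    using assms by (simp add: measure_pmf_of_set Int_absorb1)
  then show ?thesis
    unfolding coco_samples_def
    using prob_Pi_pmf_const_ball[where P = "\<lambda>y. y \<in> A" and A = "{1..g}"] by simp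
qed

text \<open>The row clears \<open>j\<close> iff all draws avoid the defective items but not all of
  them also avoid \<open>j\<close>. These two avoidance events are nested, so their probabilities
  subtract.\<close>

lemma prob_coco_row_clears:
  assumes n: "n \<ge> 1" and j: "j \<in> {1..n}" "x j \<noteq> 1"
    and d: "card {j \<in> {1..n}. x j = 1} = d"
  shows "measure_pmf.prob (coco_row n g) {r. clears n x j r} =
    (1 - real d / real n) ^ g - (1 - real d / real n - 1 / real n) ^ g"
proof -
  define A where "A = {k \<in> {1..n}. x k \<noteq> 1}"
  have A: "A \<subseteq> {1..n}" "finite A" "j \<in> A" using j by (auto simp: A_def)
  have "{1..n} = A \<union> {j \<in> {1..n}. x j = 1}" by (auto simp: A_def)
  then have "card {1..n} = card A + d"
    unfolding d[symmetric] by (metis (no_types, lifting) A_def card_Un_disjoint disjoint_iff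
        finite_Un finite_atLeastAtMost mem_Collect_eq)
  then have card_A: "real (card A) = real n - real d" by simp
  have "card A \<ge> 1" using A by (metis card_0_eq empty_iff less_one not_le)
  then have card_A': "real (card (A - {j})) = real n - real d - 1"
    using A card_A by (simp add: of_nat_diff)
  let ?S = "coco_samples n g"
  have supp: "s k \<in> {1..n}" if "s \<in> set_pmf ?S" "k \<in> {1..g}" for s k
    using that n by (auto simp: coco_samples_def set_Pi_pmf PiE_dflt_def)
  have "measure_pmf.prob (coco_row n g) {r. clears n x j r} =
    measure_pmf.prob ?S {s. clears n x j (\<lambda>j\<in>{1..n}. if \<exists>k\<in>{1..g}. s k = j then 1 else 0)}"
    unfolding coco_row_def by (simp add: vimage_def)
  also have "\<dots> = measure_pmf.prob ?S
      ({s. \<forall>k\<in>{1..g}. s k \<in> A} - {s. \<forall>k\<in>{1..g}. s k \<in> A - {j}})"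
  \<comment> \<open>The events agree only almost surely: a draw outside \<open>{1..n}\<close> would
    leave no trace in the row, yet it does not lie in \<open>A\<close>.\<close>
  proof (rule measure_pmf.finite_measure_eq_AE)
    show "AE s in measure_pmf ?S.
      (s \<in> {s. clears n x j (\<lambda>j\<in>{1..n}. if \<exists>k\<in>{1..g}. s k = j then 1 else 0)}) =
      (s \<in> {s. \<forall>k\<in>{1..g}. s k \<in> A} - {s. \<forall>k\<in>{1..g}. s k \<in> A - {j}})"
    proof (rule AE_pmfI)
      fix s assume "s \<in> set_pmf ?S"
      note supp = supp[OF this]
      show "(s \<in> {s. clears n x j (\<lambda>j\<in>{1..n}. if \<exists>k\<in>{1..g}. s k = j then 1 else 0)}) =
        (s \<in> {s. \<forall>k\<in>{1..g}. s k \<in> A} - {s. \<forall>k\<in>{1..g}. s k \<in> A - {j}})"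
        using j supp by (auto simp: clears_def A_def)
    qed
  qed auto
  also have "\<dots> = measure_pmf.prob ?S {s. \<forall>k\<in>{1..g}. s k \<in> A} -
      measure_pmf.prob ?S {s. \<forall>k\<in>{1..g}. s k \<in> A - {j}}"
    by (rule measure_pmf.finite_measure_Diff) auto
  also have "\<dots> = (real (card A) / real n) ^ g - (real (card (A - {j})) / real n) ^ g"
    using prob_coco_samples_subset[OF n, of A] prob_coco_samples_subset[OF n, of "A - {j}"] A(1)
    by (simp add: Diff_subset subset_trans[OF Diff_subset])
  finally show ?thesis
    using n unfolding card_A card_A' by (simp add: diff_divide_distrib)
qed

text \<open>Here \<open>p\<close> is any lower bound on the clearing probability, so a bound that
  depends on \<open>D\<close> alone can be inserted later.\<close>

lemma coco_error_prob_le: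
  assumes n: "n \<ge> 1" and x: "x \<in> binary_vectors n" and d: "card {j \<in> {1..n}. x j = 1} = d"
    and p: "p \<le> (1 - real d / real n) ^ g - (1 - real d / real n - 1 / real n) ^ g"
  shows "coco_error_prob n T g x \<le> real n * exp (- p * real T)"
proof -
  define N where "N = {j \<in> {1..n}. x j \<noteq> 1}"
  let ?miss = "\<lambda>j. {M. \<forall>i\<in>{1..T}. \<not> clears n x j (M i)}"
  have miss: "measure_pmf.prob (coco_matrix n T g) (?miss j) \<le> exp (- p * real T)" if "j \<in> N" for j
  proof -
    have j: "j \<in> {1..n}" "x j \<noteq> 1" using that by (auto simp: N_def)
    let ?q = "measure_pmf.prob (coco_row n g) {r. \<not> clears n x j r}"
    have "?q = 1 - measure_pmf.prob (coco_row n g) {r. clears n x j r}"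
      using measure_pmf.prob_compl[of "{r. clears n x j r}" "coco_row n g"]
      by (simp add: Compl_eq_Diff_UNIV[symmetric] Collect_neg_eq)
    also have "\<dots> \<le> 1 - p" using p prob_coco_row_clears[OF n j d] by simp
    also have "\<dots> \<le> exp (- p)" using exp_ge_add_one_self[of "- p"] by simp
    finally have "?q ^ T \<le> exp (- p) ^ T" by (intro power_mono) auto
    then show ?thesis
      unfolding coco_matrix_def
      using prob_Pi_pmf_const_ball[where P = "\<lambda>r. \<not> clears n x j r" and A = "{1..T}"]
      by (simp add: exp_of_nat_mult[symmetric] mult.commute)
  qed
  have "coco_error_prob n T g x \<le> measure_pmf.prob (coco_matrix n T g) (\<Union>j\<in>N. ?miss j)"
    unfolding coco_error_prob_def
  proof (rule measure_pmf.finite_measure_mono)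
    show "{M. coco_decode n T M (test_outcomes n T M x) \<noteq> x} \<subseteq> (\<Union>j\<in>N. ?miss j)"
      unfolding N_def using coco_decode_correct[OF x, where T = T] by blast
  qed simp
  also have "\<dots> \<le> (\<Sum>j\<in>N. measure_pmf.prob (coco_matrix n T g) (?miss j))"
    by (rule measure_pmf.finite_measure_subadditive_finite) (auto simp: N_def)
  also have "\<dots> \<le> (\<Sum>j\<in>N. exp (- p * real T))" by (intro sum_mono miss)
  also have "\<dots> = real (card N) * exp (- p * real T)" by simp
  also have "card N \<le> n" using card_mono[of "{1..n}" N] by (simp add: N_def subset_iff)
  then have "real (card N) * exp (- p * real T) \<le> real n * exp (- p * real T)"
    by (intro mult_right_mono) auto
  finally show ?thesis .
qed

section \<open>Lower bound on the clearing probability\<close>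

text \<open>The difference factors as \<open>h\<close> times a sum of products of powers of
  \<open>a - h\<close> and \<open>a\<close>, all nonnegative and increasing in \<open>a\<close>.
  With \<open>h = 1/n\<close> this makes \<open>d = D\<close> the worst case.\<close>

lemma power_increment_mono:
  fixes a b h :: real
  assumes "0 \<le> h" "h \<le> a" "a \<le> b"
  shows "a ^ g - (a - h) ^ g \<le> b ^ g - (b - h) ^ g"
proof -
  have "h * (\<Sum>i<g. (a - h) ^ (g - Suc i) * a ^ i) \<le> h * (\<Sum>i<g. (b - h) ^ (g - Suc i) * b ^ i)"
    using assms by (intro mult_left_mono sum_mono mult_mono power_mono) auto
  then show ?thesis
    using power_diff_sumr2[of a g "a - h"] power_diff_sumr2[of b g "b - h"] by simp
qed

lemma one_minus_exp_minus_ge: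
  fixes v :: real
  assumes "0 \<le> v" "v \<le> 1"
  shows "1 - exp (- v) \<ge> 3 / 5 * v"
proof -
  have pos: "0 < 1 + v + v\<^sup>2 / 2" using assms by (simp add: add_pos_nonneg)
  have "exp (- v) \<le> 1 / (1 + v + v\<^sup>2 / 2)"
    using exp_lower_Taylor_quadratic[OF assms(1)] pos by (simp add: exp_minus field_simps)
  also have "\<dots> \<le> 1 - 3 / 5 * v"
  proof -
    \<comment> \<open>This is ten times the slack in the next inequality. It vanishes at
      \<open>v = 1\<close>, so 3/5 is the largest constant that the quadratic bound yields.\<close>
    have "0 \<le> v * (4 - v - 3 * v\<^sup>2)"
      using assms power_le_one[of v 2] by (intro mult_nonneg_nonneg) auto
    then have "1 \<le> (1 - 3 / 5 * v) * (1 + v + v\<^sup>2 / 2)"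
      by (simp add: algebra_simps power2_eq_square)
    then show ?thesis using pos by (simp add: pos_divide_le_eq)
  qed
  finally show ?thesis by simp
qed

lemma clearing_prob_ge:
  assumes D: "1 \<le> D" "20 * D \<le> n" and g: "is_rounding g (coco_group_size n D)"
  shows "1 / (2 * exp 1 * real D) \<le>
    (1 - real D / real n) ^ g - (1 - real D / real n - 1 / real n) ^ g"
proof -
  define q where "q = real D / real n"
  define L where "L = ln (real n / (real n - real D))"
  \<comment> \<open>A lower bound for \<open>g / (n - D)\<close>; the subtracted term is the
    possible loss from rounding down.\<close>
  define v where "v = 1 / real D - 1 / (real n - real D)"
  have n: "real n > 0" "real D > 0" "real n - real D > 0" using D by auto
  have q: "0 < q" "q \<le> 1 / 20" using D n by (auto simp: q_def field_simps)
  have L: "L = - ln (1 - q)"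
    using n by (simp add: L_def q_def ln_div diff_divide_distrib[symmetric] field_simps)
  have "L \<le> real n / (real n - real D) - 1"
    unfolding L_def using n by (intro ln_le_minus_one) auto
  also have "\<dots> = real D / (real n - real D)" using n by (simp add: field_simps)
  finally have L_le: "L \<le> real D / (real n - real D)" .
  have L_pos: "L > 0" unfolding L using q by simp
  have r: "coco_group_size n D = 1 / L" by (simp add: coco_group_size_def L_def)
  have g_le: "real g \<le> 1 / L + 1" and g_ge: "real g \<ge> 1 / L - 1"
    using g unfolding is_rounding_def r by linarith+
  \<comment> \<open>Since \<open>1 - q = exp (- L)\<close>, rounding up costs at most one factor
    \<open>1 - q\<close>.\<close>
  have "exp (- 1) * (1 - q) = exp (- L * (1 / L + 1))"
    using L_pos q by (simp add: algebra_simps exp_add[symmetric] exp_diff L exp_minus field_simps)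
  also have "\<dots> \<le> exp (- L * real g)" using g_le L_pos by simp
  also have "\<dots> = (1 - q) ^ g" using q by (simp add: L exp_of_nat2_mult)
  finally have first: "exp (- 1) * (1 - q) \<le> (1 - q) ^ g" .

  have "(real n - real D) / real D \<le> 1 / L"
    using L_le L_pos n by (simp add: field_simps)
  then have "real g \<ge> (real n - real D) / real D - 1" using g_ge by simp
  then have "((real n - real D) / real D - 1) / (real n - real D) \<le> real g / (real n - real D)"
    using n by (intro divide_right_mono) auto
  then have "v \<le> real g / (real n - real D)"
    using n by (simp add: v_def diff_divide_distrib[of _ 1 "real n - real D"])
  moreover have "(1 - 1 / (real n - real D)) ^ g \<le> exp (- (1 / (real n - real D))) ^ g"
    using exp_ge_add_one_self[of "- (1 / (real n - real D))"] D by (intro power_mono) auto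
  ultimately have "(1 - 1 / (real n - real D)) ^ g \<le> exp (- v)"
    by (simp add: exp_of_nat_mult[symmetric] order_trans)
  moreover have v: "0 \<le> v" "v \<le> 1"
  proof -
    have "1 / (real n - real D) \<le> 1 / real D" using D by (intro divide_left_mono) auto
    then show "0 \<le> v" by (simp add: v_def)
    have "1 / real D \<le> 1" "0 \<le> 1 / (real n - real D)" using D by auto
    then show "v \<le> 1" unfolding v_def by linarith
  qed
  ultimately have second: "3 / 5 * v \<le> 1 - (1 - 1 / (real n - real D)) ^ g"
    using one_minus_exp_minus_ge[OF v] by linarith

  have "1 / (2 * exp 1 * real D) = exp (- 1) * (1 / (2 * real D))"
    by (simp add: exp_minus field_simps)
  also have "\<dots> \<le> exp (- 1) * ((1 - q) * (3 / 5 * v))"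
  proof -
    \<comment> \<open>Both rounding losses together amount to \<open>2 * q\<close>, at most 1/10.
      The product with 3/5 is then at least 27/50, just above the required 1/2.\<close>
    have "(1 - q) * v = (1 - 2 * q) / real D"
      using n by (simp add: v_def q_def divide_simps)
    moreover have "(1 - 2 * q) / real D \<ge> (9 / 10) / real D"
      using q n by (intro divide_right_mono) auto
    ultimately have "3 / 5 * ((1 - q) * v) \<ge> 3 / 5 * ((9 / 10) / real D)"
      by (intro mult_left_mono) auto
    then have "(1 - q) * (3 / 5 * v) \<ge> 27 / 50 / real D" by (simp add: algebra_simps)
    moreover have "27 / 50 / real D \<ge> 1 / (2 * real D)" using n by (simp add: field_simps)
    ultimately show ?thesis by (intro mult_left_mono) auto
  qed
  also have "\<dots> = exp (- 1) * (1 - q) * (3 / 5 * v)" by simp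
  also have "\<dots> \<le> (1 - q) ^ g * (1 - (1 - 1 / (real n - real D)) ^ g)"
    using first second v q by (intro mult_mono) auto
  also have "\<dots> = (1 - q) ^ g - ((1 - q) * (1 - 1 / (real n - real D))) ^ g"
    by (simp only: right_diff_distrib[of "(1 - q) ^ g"] mult_1_right power_mult_distrib)
  \<comment> \<open>The second factor is the ratio \<open>(n - D - 1) / (n - D)\<close> of the two
    bases.\<close>
  also have "(1 - q) * (1 - 1 / (real n - real D)) = 1 - q - 1 / real n"
    using n by (simp add: q_def divide_simps)
  finally show ?thesis by (simp add: q_def)
qed

theorem theorem3:
  fixes \<delta> :: real and D :: "nat \<Rightarrow> nat"
  assumes "\<delta> > 0"
    and "\<And>n. n \<ge> 1 \<Longrightarrow> D n \<ge> 1"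
    and "(\<lambda>n. real (D n) / real n) \<longlonglongrightarrow> 0"
  shows "\<exists>n0::nat. \<forall>n\<ge>n0. \<forall>(d::nat) (x::nat \<Rightarrow> nat) (T::nat) (g::nat).
           1 \<le> d \<and> d \<le> D n \<and>
           x \<in> binary_vectors n \<and> card {j \<in> {1..n}. x j = 1} = d \<and>
           real T \<ge> 2 * exp 1 * real (D n) * (1 + \<delta>) * ln (real n) \<and>
           is_rounding g (coco_group_size n (D n))
           \<longrightarrow> coco_error_prob n T g x \<le> real n powr (- \<delta>)"
proof -
  have "eventually (\<lambda>n. real (D n) / real n < 1 / 20) sequentially"
    using assms(3) by (rule order_tendstoD) simp
  then obtain n1 where n1: "\<And>n. n \<ge> n1 \<Longrightarrow> real (D n) / real n < 1 / 20"
    by (auto simp: eventually_sequentially)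
  show ?thesis
  proof (intro exI[of _ "max n1 1"] allI impI, elim conjE)
    fix n d T g :: nat and x :: "nat \<Rightarrow> nat"
    assume n0: "max n1 1 \<le> n" and d: "1 \<le> d" "d \<le> D n" and x: "x \<in> binary_vectors n"
      and card: "card {j \<in> {1..n}. x j = 1} = d"
      and T: "2 * exp 1 * real (D n) * (1 + \<delta>) * ln (real n) \<le> real T"
      and g: "is_rounding g (coco_group_size n (D n))"
    have n: "n \<ge> 1" "D n \<ge> 1" using n0 assms(2) by auto
    have "real (20 * D n) \<le> real n" using n1[of n] n0 by (simp add: field_simps)
    then have Dn: "20 * D n \<le> n" by (simp only: of_nat_le_iff)
    \<comment> \<open>The reciprocal of the coefficient in the bound on \<open>T\<close>, so that
      \<open>p * T\<close> is at least \<open>(1 + \<delta>) * ln n\<close>; the 1 in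
      \<open>1 + \<delta>\<close> absorbs the factor \<open>n\<close> of the union bound.\<close>
    define p where "p = 1 / (2 * exp 1 * real (D n))"
    have "p \<le> (1 - real (D n) / real n) ^ g - (1 - real (D n) / real n - 1 / real n) ^ g"
      unfolding p_def using n Dn g by (intro clearing_prob_ge)
    also have "\<dots> \<le> (1 - real d / real n) ^ g - (1 - real d / real n - 1 / real n) ^ g"
      \<comment> \<open>The side condition \<open>h \<le> a\<close> says
        \<open>D + 1 \<le> n\<close>, which follows from \<open>20 * D \<le> n\<close> and
        \<open>D \<ge> 1\<close>.\<close>
      using n Dn d by (intro power_increment_mono) (auto simp: field_simps)
    finally have "coco_error_prob n T g x \<le> real n * exp (- p * real T)"
      using n x card by (intro coco_error_prob_le)
    also have "(1 + \<delta>) * ln (real n) \<le> p * real T"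
      using T n by (simp add: p_def field_simps)
    then have "real n * exp (- p * real T) \<le> real n * exp (- ((1 + \<delta>) * ln (real n)))"
      by (intro mult_left_mono) auto
    also have "\<dots> = real n powr (- \<delta>)"
      using n by (simp add: powr_def algebra_simps exp_diff exp_minus exp_add field_simps)
    finally show "coco_error_prob n T g x \<le> real n powr (- \<delta>)" .
  qed
qed

end
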